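(* Let $H\le\mathrm{GL}(\mathbb{R}^d)$ be an admissible dilation group with open dual orbit $\mathcal{O}$, let $H_0$ be the connected component of the identity in $H$, let $\xi\in\mathcal{O}$, and assume $H_\xi\subset H_0$, where $H_\xi=\{h\in H:h^{-T}\xi=\xi\}$. Let $W\subset H$ be a relatively compact, symmetric unit neighborhood with $W\subset H_0$. Furthermore, let $\mathcal{Q}=(h_i^{-T}Q)_{i\in I}$ be an induced connected covering of $\mathcal{O}$ by $H$ with $\xi\in Q$, for some open, relatively compact $Q\subset\mathcal{O}$. Then $$p_\xi:(H,d_W)\to(\mathcal{O},d_{\mathcal{Q}}),\quad h\mapsto h^{-T}\xi$$ is a quasi-isometry. In particular $(H,d_W)$ and $(\mathcal{O},d_{\mathcal{Q}})$ are coarsely equivalent.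
   Context: A closed subgroup $H\le\mathrm{GL}(\mathbb{R}^d)$ is an admissible dilation group if the quasi-regular representation $[\pi(x,h)f](y)=|\det h|^{-1/2}f(h^{-1}(y-x))$ of $\mathbb{R}^d\rtimes H$ on $L^2(\mathbb{R}^d)$ is irreducible and square-integrable; equivalently, the dual action $(h,\xi)\mapsto h^{-T}\xi$ has a single open orbit $\mathcal{O}$ (the open dual orbit), which has full measure, and the isotropy groups $H_\xi$, $\xi\in\mathcal{O}$, are compact. A family $(h_i)_{i\in I}$ in $H$ is well-spread if there are a relatively compact unit neighborhood $U\subset H$ with $\bigcup_ih_iU=H$ and a unit neighborhood $V\subset H$ with $h_iV\cap h_jV=\emptyset$ for $i\neq j$. A covering of $\mathcal{O}$ induced by $H$ is a family $(h_i^{-T}Q)_{i\in I}$ with $Q=\{u^{-T}\xi_0:u\in U\}$ for such $(h_i)$, $U$, and some $\xi_0\in\mathcal{O}$. It is an induced connected covering if in addition all sets are open and connected and it is a structured admissible covering, i.e. $Q$ is open and precompact, $\sup_i|\{j:h_i^{-T}Q\cap h_j^{-T}Q\neq\emptyset\}|<\infty$ and $\sup\{\|h_i^Th_j^{-T}\|:h_i^{-T}Q\cap h_j^{-T}Q\ne\emptyset\}<\infty$. Metrics may take the value $\infty$. $d_{\mathcal{Q}}(x,x)=0$, and for $x\ne y$, $d_{\mathcal{Q}}(x,y)$ is the least $m\in\mathbb{N}$ such that there are $Q_1,\dots,Q_m\in\mathcal{Q}$ with $x\in Q_1$, $y\in Q_m$, $Q_k\cap Q_{k+1}\neq\emptyset$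 for $1\le k<m$ ($\infty$ if none exists). $d_W(x,x)=0$, and for $x\neq y$ in $H$, $d_W(x,y)=\inf\{m\in\mathbb{N}:x^{-1}y\in W^m\}$ ($\inf\emptyset=\infty$). Topological notions refer to the standard topologies. A map $f:(X,d_X)\to(Y,d_Y)$ is a quasi-isometry if there are $L,C>0$ with $L^{-1}d_X(x,x')-C\le d_Y(f(x),f(x'))\le Ld_X(x,x')+C$ for all $x,x'$, and $K>0$ such that every $y\in Y$ satisfies $d_Y(f(x),y)\le K$ for some $x\in X$. A map is coarse if preimages of bounded sets are bounded and for every $R>0$ there is $S>0$ with $d_X(x,x')<R\Rightarrow d_Y(f(x),f(x'))<S$. $X$ and $Y$ are coarsely equivalent if there are coarse maps $f:X\to Y$, $g:Y\to X$ with $\sup_yd_Y(f(g(y)),y)<\infty$ and $\sup_xd_X(g(f(x)),x)<\infty$. *)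

theory Defs
  imports "HOL-Analysis.Analysis"
begin

section \<open>Coarse geometry of extended metrics\<close>

text \<open>
  A space is a carrier set together with a distance function with values in
  \<^typ>\<open>ereal\<close>, since distances may be infinite. All constants are finite reals.
\<close>

definition quasi_isometry ::
  "'a set \<Rightarrow> ('a \<Rightarrow> 'a \<Rightarrow> ereal) \<Rightarrow> 'b set \<Rightarrow> ('b \<Rightarrow> 'b \<Rightarrow> ereal) \<Rightarrow> ('a \<Rightarrow> 'b) \<Rightarrow> bool" where
  "quasi_isometry X dX Y dY f \<longleftrightarrow>
     f \<in> X \<rightarrow> Y \<and>
     (\<exists>L C :: real. L > 0 \<and> C > 0 \<and>
        (\<forall>x\<in>X. \<forall>x'\<in>X.
           ereal (inverse L) * dX x x' - ereal C \<le> dY (f x) (f x') \<and>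
           dY (f x) (f x') \<le> ereal L * dX x x' + ereal C)) \<and>
     (\<exists>K :: real. K > 0 \<and> (\<forall>y\<in>Y. \<exists>x\<in>X. dY (f x) y \<le> ereal K))"

definition ext_bounded :: "('a \<Rightarrow> 'a \<Rightarrow> ereal) \<Rightarrow> 'a set \<Rightarrow> bool" where
  "ext_bounded d B \<longleftrightarrow> (\<exists>R :: real. \<forall>x\<in>B. \<forall>y\<in>B. d x y \<le> ereal R)"

definition coarse_map ::
  "'a set \<Rightarrow> ('a \<Rightarrow> 'a \<Rightarrow> ereal) \<Rightarrow> 'b set \<Rightarrow> ('b \<Rightarrow> 'b \<Rightarrow> ereal) \<Rightarrow> ('a \<Rightarrow> 'b) \<Rightarrow> bool" where
  "coarse_map X dX Y dY f \<longleftrightarrow>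
     f \<in> X \<rightarrow> Y \<and>
     (\<forall>B\<subseteq>Y. ext_bounded dY B \<longrightarrow> ext_bounded dX {x\<in>X. f x \<in> B}) \<and>
     (\<forall>R :: real. R > 0 \<longrightarrow>
        (\<exists>S :: real. S > 0 \<and>
           (\<forall>x\<in>X. \<forall>x'\<in>X. dX x x' < ereal R \<longrightarrow> dY (f x) (f x') < ereal S)))"

definition coarsely_equivalent ::
  "'a set \<Rightarrow> ('a \<Rightarrow> 'a \<Rightarrow> ereal) \<Rightarrow> 'b set \<Rightarrow> ('b \<Rightarrow> 'b \<Rightarrow> ereal) \<Rightarrow> bool" where
  "coarsely_equivalent X dX Y dY \<longleftrightarrow>
     (\<exists>f g. coarse_map X dX Y dY f \<and> coarse_map Y dY X dX g \<and>
        (SUP y\<in>Y. dY (f (g y)) y) < \<infinity> \<and> (SUP x\<in>X. dX (g (f x)) x) < \<infinity>)"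


section \<open>Closed matrix groups and the dual action\<close>

definition relatively_compact_in :: "'a::topological_space set \<Rightarrow> 'a set \<Rightarrow> bool" where
  "relatively_compact_in S A \<longleftrightarrow> A \<subseteq> S \<and> compact (top_of_set S closure_of A)"

definition closed_subgroup_GL :: "(real^'n^'n) set \<Rightarrow> bool" where
  "closed_subgroup_GL H \<longleftrightarrow>
     closedin (top_of_set {A. invertible A}) H \<and>
     mat 1 \<in> H \<and> (\<forall>a\<in>H. \<forall>b\<in>H. a ** b \<in> H) \<and> (\<forall>a\<in>H. matrix_inv a \<in> H)"

definition unit_nhd :: "(real^'n^'n) set \<Rightarrow> (real^'n^'n) set \<Rightarrow> bool" where
  "unit_nhd H U \<longleftrightarrow> U \<subseteq> H \<and> (\<exists>T. openin (top_of_set H) T \<and> mat 1 \<in> T \<and> T \<subseteq> U)"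

text \<open>The dual action $(h,\xi) \mapsto h^{-T}\xi$.\<close>

definition dual_act :: "real^'n^'n \<Rightarrow> real^'n \<Rightarrow> real^'n" where
  "dual_act h \<xi> = transpose (matrix_inv h) *v \<xi>"

definition dual_orbit :: "(real^'n^'n) set \<Rightarrow> real^'n \<Rightarrow> (real^'n) set" where
  "dual_orbit H \<xi> = (\<lambda>h. dual_act h \<xi>) ` H"

definition isotropy :: "(real^'n^'n) set \<Rightarrow> real^'n \<Rightarrow> (real^'n^'n) set" where
  "isotropy H \<xi> = {h \<in> H. dual_act h \<xi> = \<xi>}"

text \<open>
  Admissibility is expressed through the dual action: there is exactly one open dual
  orbit, it is conull, and its isotropy groups are compact. This is the standard
  criterion for the quasi-regular representation of the semidirect product of the
  translations with \<open>H\<close> to be irreducible and square-integrable.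
\<close>

definition admissible_dilation_group :: "(real^'n^'n) set \<Rightarrow> (real^'n) set \<Rightarrow> bool" where
  "admissible_dilation_group H \<O> \<longleftrightarrow>
     closed_subgroup_GL H \<and>
     {X. (\<exists>\<xi>. X = dual_orbit H \<xi>) \<and> open X} = {\<O>} \<and>
     negligible (- \<O>) \<and>
     (\<forall>\<xi>\<in>\<O>. compact (isotropy H \<xi>))"

text \<open>Word distance of \<open>W\<close>; the infimum of the empty set is \<open>\<infinity>\<close> in \<^typ>\<open>ereal\<close>.\<close>

primrec set_power :: "(real^'n^'n) set \<Rightarrow> nat \<Rightarrow> (real^'n^'n) set" where
  "set_power W 0 = {mat 1}"
| "set_power W (Suc m) = {a ** b | a b. a \<in> W \<and> b \<in> set_power W m}"

definition word_dist :: "(real^'n^'n) set \<Rightarrow> real^'n^'n \<Rightarrow> real^'n^'n \<Rightarrow> ereal" where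
  "word_dist W x y =
     (if x = y then 0
      else INF m \<in> {m. matrix_inv x ** y \<in> set_power W m}. ereal (real m))"


section \<open>Coverings\<close>

definition cover_chain :: "'a set set \<Rightarrow> 'a \<Rightarrow> 'a \<Rightarrow> nat \<Rightarrow> bool" where
  "cover_chain \<Q> x y m \<longleftrightarrow>
     m \<ge> 1 \<and>
     (\<exists>P :: nat \<Rightarrow> 'a set. (\<forall>k\<in>{1..m}. P k \<in> \<Q>) \<and> x \<in> P 1 \<and> y \<in> P m \<and>
        (\<forall>k. 1 \<le> k \<and> k < m \<longrightarrow> P k \<inter> P (k + 1) \<noteq> {}))"

definition cover_dist :: "'a set set \<Rightarrow> 'a \<Rightarrow> 'a \<Rightarrow> ereal" where
  "cover_dist \<Q> x y =
     (if x = y then 0 else INF m \<in> {m. cover_chain \<Q> x y m}. ereal (real m))"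

text \<open>
  \<open>well_spread H U I h\<close>: the family \<open>h\<close> indexed by \<open>I\<close> is well-spread in \<open>H\<close>,
  with \<open>U\<close> as a witness for the covering condition.
\<close>

definition well_spread ::
  "(real^'n^'n) set \<Rightarrow> (real^'n^'n) set \<Rightarrow> 'i set \<Rightarrow> ('i \<Rightarrow> real^'n^'n) \<Rightarrow> bool" where
  "well_spread H U I h \<longleftrightarrow>
     h \<in> I \<rightarrow> H \<and>
     unit_nhd H U \<and> relatively_compact_in H U \<and> (\<Union>i\<in>I. (\<lambda>u. h i ** u) ` U) = H \<and>
     (\<exists>V. unit_nhd H V \<and>
        (\<forall>i\<in>I. \<forall>j\<in>I. i \<noteq> j \<longrightarrow> (\<lambda>v. h i ** v) ` V \<inter> (\<lambda>v. h j ** v) ` V = {}))"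

definition cover_member ::
  "('i \<Rightarrow> real^'n^'n) \<Rightarrow> (real^'n) set \<Rightarrow> 'i \<Rightarrow> (real^'n) set" where
  "cover_member h Q i = dual_act (h i) ` Q"

definition induced_covering ::
  "(real^'n^'n) set \<Rightarrow> (real^'n) set \<Rightarrow> 'i set \<Rightarrow> ('i \<Rightarrow> real^'n^'n) \<Rightarrow> (real^'n) set \<Rightarrow> bool" where
  "induced_covering H \<O> I h Q \<longleftrightarrow>
     (\<exists>U. \<exists>\<xi>\<^sub>0\<in>\<O>. well_spread H U I h \<and> Q = (\<lambda>u. dual_act u \<xi>\<^sub>0) ` U)"

definition structured_admissible ::
  "(real^'n) set \<Rightarrow> 'i set \<Rightarrow> ('i \<Rightarrow> real^'n^'n) \<Rightarrow> (real^'n) set \<Rightarrow> bool" where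
  "structured_admissible \<O> I h Q \<longleftrightarrow>
     open Q \<and> relatively_compact_in \<O> Q \<and>
     (\<exists>N :: nat. \<forall>i\<in>I.
        finite {j\<in>I. cover_member h Q i \<inter> cover_member h Q j \<noteq> {}} \<and>
        card {j\<in>I. cover_member h Q i \<inter> cover_member h Q j \<noteq> {}} \<le> N) \<and>
     (\<exists>C :: real. \<forall>i\<in>I. \<forall>j\<in>I. cover_member h Q i \<inter> cover_member h Q j \<noteq> {} \<longrightarrow>
        onorm ((*v) (transpose (h i) ** transpose (matrix_inv (h j)))) \<le> C)"

definition induced_connected_covering ::
  "(real^'n^'n) set \<Rightarrow> (real^'n) set \<Rightarrow> 'i set \<Rightarrow> ('i \<Rightarrow> real^'n^'n) \<Rightarrow> (real^'n) set \<Rightarrow> bool" where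
  "induced_connected_covering H \<O> I h Q \<longleftrightarrow>
     induced_covering H \<O> I h Q \<and>
     (\<forall>i\<in>I. open (cover_member h Q i) \<and> connected (cover_member h Q i)) \<and>
     structured_admissible \<O> I h Q"

end

theory Submission
  imports Defs
begin

text \<open>
  Write \<open>p a = dual_act a \<xi>\<close> for the orbit map, so that \<open>p a = p b\<close> means that \<open>a\<close> and \<open>b\<close>
  differ on the right by an element of the isotropy group. The word distance is left-invariant
  and the covering is made of translates of a single set \<open>Q\<close>, so both inequalities reduce to
  uniform statements about one step.

  Properness. \<open>Q\<close> is open and is the image under \<open>p\<close> of a relatively compact set. Finitely many
  translates of \<open>Q\<close> cover any compact subset of the orbit, and the fibres of \<open>p\<close> are translates of
  a compact group; hence \<open>p\<close> is proper (\<open>orbit_map_proper\<close>) and therefore closed. Since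
  the isotropy group lies in \<open>H\<^sub>0\<close>, distinct left cosets of \<open>H\<^sub>0\<close> have disjoint images, so the image of
  a coset is closed and open in the orbit. A connected subset of the orbit thus comes from a single
  coset (\<open>connected_in_orbit_same_coset\<close>).

  Word distance from covering distance. If \<open>p x\<close> and \<open>p y\<close> lie in one connected member of the
  covering, then \<open>matrix_inv x ** y\<close> lies in \<open>H\<^sub>0\<close>, and by properness in a compact set that depends
  neither on the member nor on the points. As \<open>H\<^sub>0\<close> is connected, it is the increasing union of
  the interiors of the powers of \<open>W\<close>, so that this compact set lies in one power of \<open>W\<close>
  (\<open>compact_subset_set_power\<close>). Every link of a chain therefore costs a bounded word length.

  Covering distance from word distance. The image of \<open>W\<close> lies in a compact connected subset \<open>Z\<close> of
  the orbit that contains \<open>\<xi>\<close>. The translate of \<open>Z\<close> by \<open>x\<close> contains \<open>p x\<close> and all \<open>p (x ** w)\<close> with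
  \<open>w\<close> in \<open>W\<close>, and it meets at most \<open>M\<close> members of the covering, with \<open>M\<close> independent of \<open>x\<close>:
  by properness the elements \<open>matrix_inv x ** h j\<close> of these members lie in a fixed compact set, and a
  separated family has boundedly many elements there (\<open>separated_count\<close>). Points of a connected
  set covered by \<open>M\<close> open sets are joined by a chain of length at most \<open>M\<close>
  (\<open>connected_chain_bound\<close>). Every letter of a word therefore costs a bounded number of links.

  The orbit map is onto, so a section of it is a coarse inverse, which gives the coarse equivalence.
\<close>

section \<open>Coarse equivalence from a surjective quasi-isometry\<close>

text \<open>
  When the map is onto, a right inverse is a coarse inverse. The composite in \<open>Y\<close> is then the
  identity, and the lower estimate bounds the other composite because both points of \<open>X\<close> have the
  same image.
\<close>

lemma surjective_quasi_isometry_coarsely_equivalent: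
  assumes qi: "quasi_isometry X dX Y dY f" and surj: "f ` X = Y"
    and diag: "\<And>y. y \<in> Y \<Longrightarrow> dY y y = 0"
  shows "coarsely_equivalent X dX Y dY"
proof -
  from qi obtain L C :: real where LC: "L > 0" "C > 0"
    and lo: "\<And>x x'. x \<in> X \<Longrightarrow> x' \<in> X \<Longrightarrow> ereal (inverse L) * dX x x' - ereal C \<le> dY (f x) (f x')"
    and up: "\<And>x x'. x \<in> X \<Longrightarrow> x' \<in> X \<Longrightarrow> dY (f x) (f x') \<le> ereal L * dX x x' + ereal C"
    unfolding quasi_isometry_def by blast
  have dX_le: "dX x x' \<le> ereal (L * (R + C))"
    if "x \<in> X" "x' \<in> X" "dY (f x) (f x') \<le> ereal R" for x x' R
  proof -
    have "ereal (inverse L) * dX x x' - ereal C \<le> ereal R"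
      using lo[OF that(1,2)] that(3) by (rule order_trans)
    then show ?thesis using LC by (cases "dX x x'") (auto simp: field_simps)
  qed
  have dY_le: "dY (f x) (f x') \<le> ereal (L * R + C)"
    if "x \<in> X" "x' \<in> X" "dX x x' \<le> ereal R" for x x' R
  proof -
    have "ereal L * dX x x' + ereal C \<le> ereal (L * R + C)"
      using that(3) LC by (cases "dX x x'") auto
    with up[OF that(1,2)] show ?thesis by (rule order_trans)
  qed
  define g where "g = inv_into X f"
  have g: "g y \<in> X" "f (g y) = y" if "y \<in> Y" for y
    using that surj by (auto simp: g_def inv_into_into f_inv_into_f)
  have "coarse_map X dX Y dY f"
    unfolding coarse_map_def
  proof (intro conjI allI impI)
    show "f \<in> X \<rightarrow> Y" using surj by auto
  next
    fix B assume "B \<subseteq> Y" "ext_bounded dY B"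
    then obtain R :: real where "\<forall>x\<in>B. \<forall>y\<in>B. dY x y \<le> ereal R" by (auto simp: ext_bounded_def)
    then show "ext_bounded dX {x \<in> X. f x \<in> B}"
      unfolding ext_bounded_def by (intro exI[of _ "L * (R + C)"] ballI dX_le) auto
  next
    fix R :: real assume R: "R > 0"
    have "dY (f x) (f x') < ereal (L * R + C + 1)" if "x \<in> X" "x' \<in> X" "dX x x' < ereal R" for x x'
      using dY_le[OF that(1,2) less_imp_le[OF that(3)]] by (rule le_less_trans) simp
    moreover have "L * R + C + 1 > 0" using R LC by (simp add: add_pos_pos)
    ultimately show "\<exists>S>0. \<forall>x\<in>X. \<forall>x'\<in>X. dX x x' < ereal R \<longrightarrow> dY (f x) (f x') < ereal S" by blast
  qed
  moreover have "coarse_map Y dY X dX g"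
    unfolding coarse_map_def
  proof (intro conjI allI impI)
    show "g \<in> Y \<rightarrow> X" using g by auto
  next
    fix B assume "B \<subseteq> X" "ext_bounded dX B"
    then obtain R :: real where R: "\<forall>x\<in>B. \<forall>y\<in>B. dX x y \<le> ereal R" by (auto simp: ext_bounded_def)
    show "ext_bounded dY {y \<in> Y. g y \<in> B}"
      unfolding ext_bounded_def
    proof (intro exI[of _ "L * R + C"] ballI)
      fix y y' assume "y \<in> {y \<in> Y. g y \<in> B}" "y' \<in> {y \<in> Y. g y \<in> B}"
      then show "dY y y' \<le> ereal (L * R + C)" using dY_le[of "g y" "g y'" R] R g by auto
    qed
  next
    fix R :: real assume R: "R > 0"
    have "dX (g y) (g y') < ereal (L * (R + C) + 1)" if "y \<in> Y" "y' \<in> Y" "dY y y' < ereal R" for y y'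
    proof -
      have "dX (g y) (g y') \<le> ereal (L * (R + C))" using that g by (intro dX_le) auto
      then show ?thesis by (rule le_less_trans) simp
    qed
    moreover have "L * (R + C) + 1 > 0" using R LC by (simp add: add_pos_pos)
    ultimately show "\<exists>S>0. \<forall>x\<in>Y. \<forall>x'\<in>Y. dY x x' < ereal R \<longrightarrow> dX (g x) (g x') < ereal S" by blast
  qed
  moreover have "(SUP y\<in>Y. dY (f (g y)) y) \<le> 0"
    using g diag by (intro SUP_least) simp
  moreover have "(SUP x\<in>X. dX (g (f x)) x) \<le> ereal (L * (0 + C))"
  proof (intro SUP_least dX_le)
    fix x assume "x \<in> X"
    then have "f x \<in> Y" using surj by auto
    then show "g (f x) \<in> X" "x \<in> X" "dY (f (g (f x))) (f x) \<le> ereal 0"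
      using g diag \<open>x \<in> X\<close> by (auto simp flip: zero_ereal_def)
  qed
  ultimately show ?thesis
    unfolding coarsely_equivalent_def
    by (intro exI[of _ f] exI[of _ g]) (auto intro: le_less_trans)
qed


section \<open>Chains of covering sets\<close>

definition link :: "'a set set \<Rightarrow> ('a \<times> 'a) set" where
  "link \<Q> = {(x, y). \<exists>P\<in>\<Q>. x \<in> P \<and> y \<in> P}"

lemma linkI: "P \<in> \<Q> \<Longrightarrow> x \<in> P \<Longrightarrow> y \<in> P \<Longrightarrow> (x, y) \<in> link \<Q>"
  by (auto simp: link_def)

text \<open>
  Iterated composition of a relation makes concatenating and splitting chains available as facts
  on powers of \<open>link\<close>. The points of such a power are the endpoints of the chain together with one
  point in each intersection of neighbouring sets.
\<close>

lemma cover_chain_iff_relpow: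
  assumes "m \<ge> 1"
  shows "cover_chain \<Q> x y m \<longleftrightarrow> (x, y) \<in> link \<Q> ^^ m"
proof
  assume "cover_chain \<Q> x y m"
  then obtain P where P: "\<forall>k\<in>{1..m}. P k \<in> \<Q>" "x \<in> P 1" "y \<in> P m"
    and ne: "\<forall>k. 1 \<le> k \<and> k < m \<longrightarrow> P k \<inter> P (k + 1) \<noteq> {}"
    by (auto simp: cover_chain_def)
  from ne obtain z where z: "\<And>k. 1 \<le> k \<Longrightarrow> k < m \<Longrightarrow> z k \<in> P k \<inter> P (k + 1)"
    using choice[of "\<lambda>k w. 1 \<le> k \<and> k < m \<longrightarrow> w \<in> P k \<inter> P (k + 1)"] by blast
  \<comment> \<open>The points of the chain: the two endpoints, and in between the chosen points of the intersections.\<close>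
  define f where "f k = (if k = 0 then x else if k = m then y else z k)" for k
  have "(f i, f (Suc i)) \<in> link \<Q>" if "i < m" for i
  proof (rule linkI)
    show "P (Suc i) \<in> \<Q>" using P(1) that by auto
    show "f i \<in> P (Suc i)" using P(2) z[of i] that by (auto simp: f_def)
    show "f (Suc i) \<in> P (Suc i)" using P(3) z[of "Suc i"] that by (auto simp: f_def)
  qed
  moreover have "f 0 = x" "f m = y" using assms by (auto simp: f_def)
  ultimately show "(x, y) \<in> link \<Q> ^^ m" unfolding relpow_fun_conv by blast
next
  assume "(x, y) \<in> link \<Q> ^^ m"
  then obtain f where f: "f 0 = x" "f m = y" "\<forall>i<m. (f i, f (Suc i)) \<in> link \<Q>"
    unfolding relpow_fun_conv by blast
  then obtain P where P: "\<And>i. i < m \<Longrightarrow> P i \<in> \<Q> \<and> f i \<in> P i \<and> f (Suc i) \<in> P i"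
    unfolding link_def by simp metis
  have "x \<in> P (1 - 1)" "y \<in> P (m - 1)"
    using P[of 0] P[of "m - 1"] f assms by auto
  moreover have "P (k - 1) \<inter> P (k + 1 - 1) \<noteq> {}" if "1 \<le> k \<and> k < m" for k
    using P[of "k - 1"] P[of k] that by (cases k) auto
  moreover have "\<forall>k\<in>{1..m}. P (k - 1) \<in> \<Q>" using P by auto
  ultimately show "cover_chain \<Q> x y m"
    unfolding cover_chain_def using assms by (intro conjI exI[of _ "\<lambda>k. P (k - 1)"]) auto
qed

text \<open>
  A chain can be prolonged at will by repeating its last point, since \<open>link\<close> is reflexive on the
  union of the covering; this turns bounds on lengths into equalities.
\<close>

lemma relpow_link_mono:
  assumes "(x, y) \<in> link \<Q> ^^ m" "y \<in> \<Union>\<Q>" "m \<le> n"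
  shows "(x, y) \<in> link \<Q> ^^ n"
  using assms(3)
proof (induction n rule: dec_induct)
  case (step n)
  have "(y, y) \<in> link \<Q>" using assms(2) by (auto intro: linkI)
  with step.IH show ?case by (rule relpow_Suc_I)
qed (rule assms)

lemma cover_dist_nonneg: "0 \<le> cover_dist \<Q> x y"
  by (auto simp: cover_dist_def intro: INF_greatest)

lemma cover_dist_le:
  assumes "(x, y) \<in> link \<Q> ^^ m"
  shows "cover_dist \<Q> x y \<le> ereal (real m)"
proof (cases "x = y")
  case False
  with assms have "m \<ge> 1" by (cases m) auto
  with assms have "cover_chain \<Q> x y m" by (simp add: cover_chain_iff_relpow)
  with False show ?thesis by (auto simp: cover_dist_def intro: INF_lower)
qed (simp add: cover_dist_def)

text \<open>
  Starting from the members that contain \<open>x\<close>, add in each round those members that contain a point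
  reached so far. As long as the collection grows, it gains at least one of the finitely many
  members in each round, so it becomes stable before \<open>card F\<close> rounds are over. Once stable,
  its union is disjoint from the union of the remaining members, and connectedness forces it to
  cover \<open>S\<close>.
\<close>

lemma connected_chain_bound:
  fixes S :: "'a::topological_space set"
  assumes "connected S" "finite F" "F \<subseteq> \<Q>" "S \<subseteq> \<Union>F"
    and op: "\<And>P. P \<in> F \<Longrightarrow> open P"
    and xy: "x \<in> S" "y \<in> S"
  shows "\<exists>m\<le>card F. (x, y) \<in> link \<Q> ^^ m"
proof -
  define lev where "lev k = {P \<in> F. \<exists>z\<in>P. (x, z) \<in> link \<Q> ^^ k}" for k
  have levF: "lev k \<subseteq> F" for k by (auto simp: lev_def)
  have fin: "finite (lev k)" for k using levF assms(2) by (rule finite_subset)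
  have mono: "lev k \<subseteq> lev (Suc k)" for k
    unfolding lev_def using assms(3) by (blast intro: relpow_Suc_I linkI)
  have "\<exists>k<card F. lev (Suc k) = lev k"
  proof (rule ccontr)
    assume "\<not> ?thesis"
    then have strict: "lev k \<subset> lev (Suc k)" if "k < card F" for k using mono[of k] that by blast
    have "k < card (lev k)" if "k \<le> card F" for k
      using that
    proof (induction k)
      case 0
      have "lev 0 \<noteq> {}" using xy(1) assms(4) by (auto simp: lev_def)
      then show ?case using fin[of 0] by (simp add: card_gt_0_iff)
    next
      case (Suc k)
      then have "card (lev k) < card (lev (Suc k))" by (intro psubset_card_mono fin strict) simp
      with Suc show ?case by simp
    qed
    then have "card F < card (lev (card F))" by simp
    moreover have "card (lev (card F)) \<le> card F" by (intro card_mono assms(2) levF)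
    ultimately show False by simp
  qed
  then obtain k where k: "k < card F" "lev (Suc k) = lev k" by blast
  have disj: "P \<inter> P' = {}" if "P \<in> lev k" "P' \<in> F - lev k" for P P'
  proof (rule ccontr)
    assume "P \<inter> P' \<noteq> {}"
    then obtain w where w: "w \<in> P" "w \<in> P'" by blast
    from that obtain z where z: "z \<in> P" "(x, z) \<in> link \<Q> ^^ k" and "P \<in> F" by (auto simp: lev_def)
    have "(x, w) \<in> link \<Q> ^^ Suc k"
      using z w \<open>P \<in> F\<close> assms(3) by (blast intro: relpow_Suc_I linkI)
    then have "P' \<in> lev (Suc k)" using w that by (auto simp: lev_def)
    then show False using k that by blast
  qed
  have "S \<subseteq> \<Union>(lev k)"
  proof -
    have "open (\<Union>(lev k))" "open (\<Union>(F - lev k))" using levF op by blast+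
    moreover have "\<Union>(lev k) \<inter> \<Union>(F - lev k) \<inter> S = {}" using disj by blast
    moreover have "S \<subseteq> \<Union>(lev k) \<union> \<Union>(F - lev k)" using assms(4) by blast
    ultimately have "\<Union>(lev k) \<inter> S = {} \<or> \<Union>(F - lev k) \<inter> S = {}"
      using connectedD[OF assms(1)] by blast
    moreover have "x \<in> \<Union>(lev k)"
    proof -
      have "x \<in> \<Union>(lev 0)" using xy(1) assms(4) by (auto simp: lev_def)
      moreover have "lev 0 \<subseteq> lev k" by (rule lift_Suc_mono_le[of lev, OF mono]) simp
      ultimately show ?thesis by blast
    qed
    ultimately show ?thesis using xy(1) assms(4) by blast
  qed
  then obtain P z where "P \<in> F" "y \<in> P" "z \<in> P" "(x, z) \<in> link \<Q> ^^ k"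
    using xy(2) by (auto simp: lev_def)
  then have "(x, y) \<in> link \<Q> ^^ Suc k" using assms(3) by (blast intro: relpow_Suc_I linkI)
  with k(1) show ?thesis by (intro exI[of _ "Suc k"]) auto
qed


section \<open>Word powers and word distance\<close>

lemma set_power_Suc_I: "a \<in> W \<Longrightarrow> b \<in> set_power W m \<Longrightarrow> a ** b \<in> set_power W (Suc m)"
  by auto

lemma set_power_add: "a \<in> set_power W m \<Longrightarrow> b \<in> set_power W n \<Longrightarrow> a ** b \<in> set_power W (m + n)"
proof (induction m arbitrary: a)
  case (Suc m)
  then obtain c d where "a = c ** d" "c \<in> W" "d \<in> set_power W m" by auto
  with Suc show ?case
    using set_power_Suc_I[of c W "d ** b" "m + n"] by (simp add: matrix_mul_assoc)
qed simp

lemma set_power_mono: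
  assumes "mat 1 \<in> W" "m \<le> n"
  shows "set_power W m \<subseteq> set_power W n"
  using assms(2)
proof (induction n rule: dec_induct)
  case (step n)
  have "set_power W n \<subseteq> set_power W (Suc n)"
    using set_power_Suc_I[OF assms(1)] by fastforce
  with step.IH show ?case by blast
qed simp

lemma word_dist_nonneg: "0 \<le> word_dist W x y"
  by (auto simp: word_dist_def intro: INF_greatest)

lemma word_dist_le:
  assumes "matrix_inv x ** y \<in> set_power W m"
  shows "word_dist W x y \<le> ereal (real m)"
  using assms by (auto simp: word_dist_def intro: INF_lower)

text \<open>
  The factor is moved to the left as a divisor, so that the infimum stands alone on the right and
  the claim can be checked for each word length; this also covers an infinite distance.
\<close>

lemma cover_dist_le_word_dist:
  assumes "\<And>m. matrix_inv x ** y \<in> set_power W m \<Longrightarrow> (f x, f y) \<in> link \<Q> ^^ (M * m)"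
    and "M > 0"
  shows "cover_dist \<Q> (f x) (f y) \<le> ereal (real M) * word_dist W x y"
proof (cases "x = y")
  case False
  have "cover_dist \<Q> (f x) (f y) / ereal (real M) \<le> word_dist W x y"
    unfolding word_dist_def if_not_P[OF False]
  proof (rule INF_greatest)
    fix m assume "m \<in> {m. matrix_inv x ** y \<in> set_power W m}"
    then have "cover_dist \<Q> (f x) (f y) \<le> ereal (real (M * m))"
      by (intro cover_dist_le assms(1)) simp
    then show "cover_dist \<Q> (f x) (f y) / ereal (real M) \<le> ereal (real m)"
      using assms(2) by (simp add: ereal_divide_le_pos)
  qed
  then show ?thesis using assms(2) by (simp add: ereal_divide_le_pos)
qed (simp add: cover_dist_def word_dist_def flip: zero_ereal_def)

text \<open>
  The summand \<open>1\<close> pays for distinct elements with the same image: their covering distance is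
  \<open>0\<close>, which is the instance \<open>m = 0\<close> of the hypothesis.
\<close>

lemma word_dist_le_cover_dist:
  assumes "\<And>m. (f x, f y) \<in> link \<Q> ^^ m \<Longrightarrow> matrix_inv x ** y \<in> set_power W (k * Suc m)"
    and "k > 0"
  shows "word_dist W x y \<le> ereal (real k) * (cover_dist \<Q> (f x) (f y) + 1)"
proof (cases "f x = f y")
  case True
  then show ?thesis using word_dist_le[OF assms(1)[of 0]] by (simp add: cover_dist_def)
next
  case False
  have "word_dist W x y / ereal (real k) - 1 \<le> cover_dist \<Q> (f x) (f y)"
    unfolding cover_dist_def if_not_P[OF False]
  proof (rule INF_greatest)
    fix m assume "m \<in> {m. cover_chain \<Q> (f x) (f y) m}"
    then have "m \<ge> 1" "cover_chain \<Q> (f x) (f y) m" by (auto simp: cover_chain_def)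
    then have "word_dist W x y \<le> ereal (real (k * Suc m))"
      by (intro word_dist_le assms(1)) (simp add: cover_chain_iff_relpow)
    then have "word_dist W x y / ereal (real k) \<le> ereal (real (Suc m))"
      using assms(2) by (simp add: ereal_divide_le_pos algebra_simps)
    then show "word_dist W x y / ereal (real k) - 1 \<le> ereal (real m)"
      by (cases "word_dist W x y / ereal (real k)") (auto simp: one_ereal_def)
  qed
  then have "word_dist W x y / ereal (real k) \<le> cover_dist \<Q> (f x) (f y) + 1"
    by (simp add: ereal_minus_le)
  then show ?thesis using assms(2) by (simp add: ereal_divide_le_pos)
qed


section \<open>Compact sets and compact connected sets\<close>

text \<open>
  In the connected component of \<open>S\<close> that contains \<open>T\<close>, every point of \<open>L\<close> can be joined to \<open>a\<close> by a path,
  and a path together with a small closed ball around its endpoint is a compact connected neighbourhood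
  of that endpoint. Finitely many of them cover \<open>L\<close>, and their union is connected because all
  of them contain \<open>a\<close>.
\<close>

lemma compact_connected_superset:
  fixes S T L :: "'a::euclidean_space set"
  assumes "open S" "connected T" "T \<subseteq> S" "compact L" "L \<subseteq> T" "a \<in> T"
  obtains K where "compact K" "connected K" "a \<in> K" "L \<subseteq> K" "K \<subseteq> S"
proof -
  define C where "C = connected_component_set S a"
  have C: "open C" "connected C" "C \<subseteq> S" "T \<subseteq> C" "a \<in> C"
    unfolding C_def
    using assms connected_component_maximal[of a T S] connected_component_refl[of a S]
    by (auto simp: open_connected_component connected_component_subset)
  then have pc: "path_connected C" by (simp add: connected_open_path_connected)
  have "\<exists>K. compact K \<and> connected K \<and> a \<in> K \<and> K \<subseteq> S \<and> l \<in> interior K" if "l \<in> L" for l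
  proof -
    have lC: "l \<in> C" using that assms C by blast
    then obtain e where e: "e > 0" "cball l e \<subseteq> C" using C(1) open_contains_cball by blast
    obtain g where g: "path g" "path_image g \<subseteq> C" "pathstart g = a" "pathfinish g = l"
      using pc lC C(5) unfolding path_connected_def by blast
    have ends: "a \<in> path_image g" "l \<in> path_image g"
      using g pathstart_in_path_image pathfinish_in_path_image by metis+
    have "connected (path_image g \<union> cball l e)"
      using ends e by (intro connected_Un connected_path_image g(1)) auto
    moreover have "compact (path_image g \<union> cball l e)" by (intro compact_Un compact_path_image g(1)) simp
    moreover have "l \<in> interior (path_image g \<union> cball l e)"
      using e interior_mono[of "cball l e" "path_image g \<union> cball l e"] by auto
    ultimately show ?thesis using ends e g(2) C(3) by (intro exI[of _ "path_image g \<union> cball l e"]) auto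
  qed
  then obtain \<kappa> where \<kappa>: "\<And>l. l \<in> L \<Longrightarrow> compact (\<kappa> l) \<and> connected (\<kappa> l) \<and> a \<in> \<kappa> l \<and> \<kappa> l \<subseteq> S \<and> l \<in> interior (\<kappa> l)"
    by metis
  obtain L' where L': "L' \<subseteq> L" "finite L'" "L \<subseteq> (\<Union>l\<in>L'. interior (\<kappa> l))"
    using compactE_image[OF assms(4), of L "\<lambda>l. interior (\<kappa> l)"] \<kappa> by (metis UN_I open_interior subsetI)
  define K where "K = \<Union>(insert {a} (\<kappa> ` L'))"
  have "connected K"
    unfolding K_def by (rule connected_Union) (use \<kappa> L' in auto)
  moreover have "compact K" unfolding K_def using L' \<kappa> by (intro compact_Union) auto
  moreover have "L \<subseteq> K" 
  proof
    fix l assume "l \<in> L"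
    then obtain l' where "l' \<in> L'" "l \<in> \<kappa> l'" using L'(3) interior_subset by blast
    then show "l \<in> K" unfolding K_def by blast
  qed
  moreover have "a \<in> K" "K \<subseteq> S" unfolding K_def using \<kappa> L' assms by auto
  ultimately show ?thesis using that by blast
qed


lemma relatively_compact_inE:
  assumes "relatively_compact_in S A"
  obtains K where "compact K" "A \<subseteq> K" "K \<subseteq> S" "\<And>C. closedin (top_of_set S) C \<Longrightarrow> A \<subseteq> C \<Longrightarrow> K \<subseteq> C"
proof (rule that[of "top_of_set S closure_of A"])
  show "compact (top_of_set S closure_of A)" using assms by (simp add: relatively_compact_in_def)
  show "A \<subseteq> top_of_set S closure_of A"
    using assms by (intro closure_of_subset) (simp add: relatively_compact_in_def)
  show "top_of_set S closure_of A \<subseteq> S"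
    using closure_of_subset_topspace[of "top_of_set S" A] by simp
qed (auto intro: closure_of_minimal[THEN subsetD])


section \<open>The matrix operations and the dual action\<close>

lemma tendsto_det:
  fixes f :: "'a \<Rightarrow> real^'n^'n"
  assumes "(f \<longlongrightarrow> A) F"
  shows "((\<lambda>x. det (f x)) \<longlongrightarrow> det A) F"
  unfolding det_def by (intro tendsto_intros assms)

lemma matrix_inv_left_right:
  fixes A :: "'a::semiring_1^'n^'m"
  assumes "invertible A"
  shows "A ** matrix_inv A = mat 1" "matrix_inv A ** A = mat 1"
  using someI_ex[of "\<lambda>B. A ** B = mat 1 \<and> B ** A = mat 1"] assms
  by (auto simp: invertible_def matrix_inv_def)

lemma matrix_inv_eqI:
  fixes A B :: "real^'n^'n"
  assumes "A ** B = mat 1"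
  shows "matrix_inv A = B"
proof -
  have "invertible A" using assms invertible_right_inverse by blast
  then have "matrix_inv A ** (A ** B) = B"
    by (simp add: matrix_mul_assoc matrix_inv_left_right)
  with assms show ?thesis by simp
qed

text \<open>
  Only the continuity of the right-hand side matters later: this formula shows that inversion is
  continuous on the invertible matrices.
\<close>

lemma matrix_inv_cramer:
  fixes A :: "real^'n^'n"
  assumes "invertible A"
  shows "matrix_inv A = (\<chi> k l. det (\<chi> i j. if j = k then axis l 1 $ i else A $ i $ j) / det A)"
proof -
  have d: "det A \<noteq> 0" using assms invertible_det_nz by blast
  have "matrix_inv A $ k $ l = det (\<chi> i j. if j = k then axis l 1 $ i else A $ i $ j) / det A" for k l
  proof -
    have "A *v (matrix_inv A *v axis l 1) = axis l 1"
      using assms by (simp add: matrix_vector_mul_assoc matrix_inv_left_right)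
    then have "matrix_inv A *v axis l 1 =
        (\<chi> k. det (\<chi> i j. if j = k then axis l 1 $ i else A $ i $ j) / det A)"
      using cramer[OF d] by blast
    moreover have "(matrix_inv A *v axis l 1) $ k = matrix_inv A $ k $ l"
      by (simp add: matrix_vector_mult_basis column_def)
    ultimately show ?thesis by simp
  qed
  then show ?thesis by (simp add: vec_eq_iff)
qed

lemma continuous_on_matrix_inv [continuous_intros]:
  fixes f :: "'a::topological_space \<Rightarrow> real^'n^'n"
  assumes "continuous_on S f" "\<And>x. x \<in> S \<Longrightarrow> invertible (f x)"
  shows "continuous_on S (\<lambda>x. matrix_inv (f x))"
proof -
  have "continuous_on S (\<lambda>x. \<chi> k l. det (\<chi> i j. if j = k then axis l 1 $ i else f x $ i $ j) / det (f x))"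
    unfolding continuous_on_def
  proof (intro ballI)
    fix x assume x: "x \<in> S"
    have fx: "(f \<longlongrightarrow> f x) (at x within S)" using assms(1) x by (simp add: continuous_on_def)
    have "((\<lambda>y. \<chi> i j. if j = k then axis l 1 $ i else f y $ i $ j) \<longlongrightarrow>
       (\<chi> i j. if j = k then axis l 1 $ i else f x $ i $ j)) (at x within S)" for k l
      by (intro tendsto_vec_lambda) (auto intro!: tendsto_vec_nth fx)
    note dd = tendsto_det[OF this]
    show "((\<lambda>x. \<chi> k l. det (\<chi> i j. if j = k then axis l 1 $ i else f x $ i $ j) / det (f x)) \<longlongrightarrow>
        (\<chi> k l. det (\<chi> i j. if j = k then axis l 1 $ i else f x $ i $ j) / det (f x))) (at x within S)"
      using assms(2)[OF x] by (intro tendsto_vec_lambda tendsto_divide dd tendsto_det[OF fx]) (simp add: invertible_det_nz)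
  qed
  then show ?thesis
    by (rule continuous_on_eq) (rule matrix_inv_cramer[OF assms(2), symmetric])
qed

lemma continuous_on_matrix_mult [continuous_intros]:
  fixes f :: "'a::topological_space \<Rightarrow> real^'n^'m" and g :: "'a \<Rightarrow> real^'k^'n"
  assumes "continuous_on S f" "continuous_on S g"
  shows "continuous_on S (\<lambda>x. f x ** g x)"
  unfolding matrix_matrix_mult_def by (intro continuous_intros assms)

lemma continuous_on_dual_act [continuous_intros]:
  fixes f :: "'a::topological_space \<Rightarrow> real^'n^'n" and g :: "'a \<Rightarrow> real^'n"
  assumes "continuous_on S f" "\<And>x. x \<in> S \<Longrightarrow> invertible (f x)" "continuous_on S g"
  shows "continuous_on S (\<lambda>x. dual_act (f x) (g x))"
  unfolding dual_act_def matrix_vector_mult_def transpose_def by simp (intro continuous_intros assms)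

lemma dual_act_mult:
  assumes "invertible a" "invertible b"
  shows "dual_act (a ** b) \<xi> = dual_act a (dual_act b \<xi>)"
proof -
  have "matrix_inv (a ** b) = matrix_inv b ** matrix_inv a"
    by (rule matrix_inv_eqI) (metis assms matrix_inv_left_right(1) matrix_mul_assoc matrix_mul_rid)
  then show ?thesis
    by (simp add: dual_act_def matrix_transpose_mul matrix_vector_mul_assoc del: transpose_matrix_vector)
qed

lemma dual_act_one [simp]: "dual_act (mat 1) \<xi> = \<xi>" for \<xi> :: "real^'n"
proof -
  have "matrix_inv (mat 1 :: real^'n^'n) = mat 1" by (rule matrix_inv_eqI) simp
  then show ?thesis by (simp only: dual_act_def transpose_mat matrix_vector_mul_lid)
qed


section \<open>Matrix groups\<close>

locale matrix_group =
  fixes H :: "(real^'n^'n) set"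
  assumes invertible: "a \<in> H \<Longrightarrow> invertible a"
    and one_mem [simp]: "mat 1 \<in> H"
    and mult_mem [simp]: "a \<in> H \<Longrightarrow> b \<in> H \<Longrightarrow> a ** b \<in> H"
    and inv_mem [simp]: "a \<in> H \<Longrightarrow> matrix_inv a \<in> H"
begin

lemma inv_mult [simp]: "a \<in> H \<Longrightarrow> matrix_inv a ** a = mat 1"
  and mult_inv [simp]: "a \<in> H \<Longrightarrow> a ** matrix_inv a = mat 1"
  by (simp_all add: invertible matrix_inv_left_right)

lemma inv_mult_cancel [simp]: "a \<in> H \<Longrightarrow> matrix_inv a ** (a ** b) = b"
  and mult_inv_cancel [simp]: "a \<in> H \<Longrightarrow> a ** (matrix_inv a ** b) = b"
  and mult_cancel_inv [simp]: "a \<in> H \<Longrightarrow> b ** a ** matrix_inv a = b"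
  and inv_cancel_mult [simp]: "a \<in> H \<Longrightarrow> b ** matrix_inv a ** a = b"
   apply (simp_all add: matrix_mul_assoc)
   apply (simp_all flip: matrix_mul_assoc)
  done

lemma inv_inv [simp]: "a \<in> H \<Longrightarrow> matrix_inv (matrix_inv a) = a"
  by (intro matrix_inv_eqI) simp

lemma act_mult: "a \<in> H \<Longrightarrow> b \<in> H \<Longrightarrow> dual_act (a ** b) \<xi> = dual_act a (dual_act b \<xi>)"
  by (simp add: dual_act_mult invertible)

lemma act_inv [simp]: "a \<in> H \<Longrightarrow> dual_act (matrix_inv a) (dual_act a \<xi>) = \<xi>"
  by (simp flip: act_mult)

lemma act_eq_iff:
  assumes "a \<in> H" "b \<in> H"
  shows "dual_act a \<xi> = dual_act b \<xi> \<longleftrightarrow> matrix_inv a ** b \<in> isotropy H \<xi>"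
proof
  assume "dual_act a \<xi> = dual_act b \<xi>"
  then show "matrix_inv a ** b \<in> isotropy H \<xi>"
    using assms by (simp add: isotropy_def act_mult flip: \<open>dual_act a \<xi> = dual_act b \<xi>\<close>)
next
  assume "matrix_inv a ** b \<in> isotropy H \<xi>"
  then have "dual_act a (dual_act (matrix_inv a ** b) \<xi>) = dual_act a \<xi>" by (simp add: isotropy_def)
  then show "dual_act a \<xi> = dual_act b \<xi>" using assms by (simp flip: act_mult)
qed

lemma continuous_inv: "continuous_on S f \<Longrightarrow> f ` S \<subseteq> H \<Longrightarrow> continuous_on S (\<lambda>x. matrix_inv (f x))"
  by (intro continuous_on_matrix_inv) (auto intro: invertible)

lemma continuous_act:
  "continuous_on S f \<Longrightarrow> f ` S \<subseteq> H \<Longrightarrow> continuous_on S (\<lambda>x. dual_act (f x) \<xi>)"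
  by (intro continuous_on_dual_act) (auto intro: invertible)

lemma continuous_dual_act: "a \<in> H \<Longrightarrow> continuous_on S (dual_act a)"
  by (intro continuous_on_dual_act continuous_on_const continuous_on_id) (auto intro: invertible)

lemma compact_mult:
  assumes "compact A" "compact B" "A \<subseteq> H" "B \<subseteq> H"
  obtains K where "compact K" "K \<subseteq> H" "\<And>a b. a \<in> A \<Longrightarrow> b \<in> B \<Longrightarrow> a ** b \<in> K"
proof -
  have "continuous_on (A \<times> B) (\<lambda>x. fst x ** snd x)" by (intro continuous_intros)
  then have "compact ((\<lambda>x. fst x ** snd x) ` (A \<times> B))"
    using assms by (intro compact_continuous_image compact_Times)
  then show ?thesis using assms by (intro that[of "(\<lambda>x. fst x ** snd x) ` (A \<times> B)"]) force+
qed

lemma compact_inv: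
  assumes "compact A" "A \<subseteq> H"
  shows "compact (matrix_inv ` A)" "matrix_inv ` A \<subseteq> H"
  using assms continuous_inv[of A "\<lambda>a. a"] by (auto intro: compact_continuous_image)

lemma openin_left_preimage:
  assumes "openin (top_of_set H) T" "a \<in> H"
  shows "openin (top_of_set H) {b \<in> H. matrix_inv a ** b \<in> T}"
proof -
  have "openin (top_of_set H) (H \<inter> (\<lambda>b. matrix_inv a ** b) -` T)"
    using assms by (intro continuous_openin_preimage[where T = H] continuous_intros) auto
  then show ?thesis by (simp add: vimage_def Int_def)
qed

lemma closedin_left_preimage:
  assumes "closedin (top_of_set H) T" "a \<in> H"
  shows "closedin (top_of_set H) {b \<in> H. matrix_inv a ** b \<in> T}"
proof -
  have "closedin (top_of_set H) (H \<inter> (\<lambda>b. matrix_inv a ** b) -` T)"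
    using assms by (intro continuous_closedin_preimage_gen[where T = H] continuous_intros) auto
  then show ?thesis by (simp add: vimage_def Int_def)
qed

lemma openin_right_preimage:
  assumes "openin (top_of_set H) T" "a \<in> H"
  shows "openin (top_of_set H) {b \<in> H. b ** matrix_inv a \<in> T}"
proof -
  have "openin (top_of_set H) (H \<inter> (\<lambda>b. b ** matrix_inv a) -` T)"
    using assms by (intro continuous_openin_preimage[where T = H] continuous_intros) auto
  then show ?thesis by (simp add: vimage_def Int_def)
qed

lemma compact_openin_cover:
  assumes "compact C" "C \<subseteq> H" "\<And>x. x \<in> C \<Longrightarrow> openin (top_of_set H) (N x) \<and> x \<in> N x"
  obtains F where "finite F" "F \<subseteq> C" "C \<subseteq> (\<Union>x\<in>F. N x)"
proof -
  have "compactin (top_of_set H) C" using assms by (simp add: compactin_subtopology)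
  then obtain \<F> where "finite \<F>" "\<F> \<subseteq> N ` C" "C \<subseteq> \<Union>\<F>"
    using assms(3) compactinD[of "top_of_set H" C "N ` C"] by blast
  moreover then obtain F where "F \<subseteq> C" "finite F" "\<F> = N ` F"
    using finite_subset_image by metis
  ultimately show ?thesis using that[of F] by simp
qed


subsection \<open>The identity component\<close>

abbreviation "H\<^sub>0 \<equiv> connected_component_set H (mat 1)"

lemma identity_component_subset: "H\<^sub>0 \<subseteq> H"
  by (rule connected_component_subset)

lemma one_mem_identity_component: "mat 1 \<in> H\<^sub>0"
  using connected_component_refl[of "mat 1" H] by simp

text \<open>
  The translate of the identity component by \<open>a\<close> is connected and contains \<open>a\<close>, hence stays in the
  component of \<open>a\<close>, which is the identity component again.
\<close>

lemma identity_component_mult: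
  assumes "a \<in> H\<^sub>0" "b \<in> H\<^sub>0"
  shows "a ** b \<in> H\<^sub>0"
proof -
  have "connected ((\<lambda>c. a ** c) ` H\<^sub>0)"
    by (intro connected_continuous_image continuous_intros) simp
  moreover have "a \<in> (\<lambda>c. a ** c) ` H\<^sub>0"
    using one_mem_identity_component by (intro image_eqI[of _ _ "mat 1"]) auto
  moreover have "(\<lambda>c. a ** c) ` H\<^sub>0 \<subseteq> H"
    using assms(1) identity_component_subset by (blast intro: mult_mem)
  ultimately have "(\<lambda>c. a ** c) ` H\<^sub>0 \<subseteq> connected_component_set H a"
    by (intro connected_component_maximal)
  also have "\<dots> = H\<^sub>0" using assms(1) connected_component_eq by fast
  finally show ?thesis using assms(2) by blast
qed

lemma openin_identity_component:
  assumes "unit_nhd H W" "W \<subseteq> H\<^sub>0"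
  shows "openin (top_of_set H) H\<^sub>0"
proof (subst openin_subopen, intro ballI)
  fix a assume a: "a \<in> H\<^sub>0"
  then have aH: "a \<in> H" using identity_component_subset by blast
  obtain T where T: "openin (top_of_set H) T" "mat 1 \<in> T" "T \<subseteq> W"
    using assms(1) by (auto simp: unit_nhd_def)
  have "{b \<in> H. matrix_inv a ** b \<in> T} \<subseteq> H\<^sub>0"
  proof
    fix b assume "b \<in> {b \<in> H. matrix_inv a ** b \<in> T}"
    then have "matrix_inv a ** b \<in> H\<^sub>0" using T(3) assms(2) by blast
    then have "a ** (matrix_inv a ** b) \<in> H\<^sub>0" by (rule identity_component_mult[OF a])
    then show "b \<in> H\<^sub>0" using aH by simp
  qed
  then show "\<exists>T'. openin (top_of_set H) T' \<and> a \<in> T' \<and> T' \<subseteq> H\<^sub>0"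
    using openin_left_preimage[OF T(1) aH] aH T(2) by (intro exI[of _ "{b \<in> H. matrix_inv a ** b \<in> T}"]) auto
qed


subsection \<open>Growth of word powers\<close>

lemma set_power_subset: "W \<subseteq> H \<Longrightarrow> set_power W m \<subseteq> H"
  by (induction m) (auto intro!: mult_mem)

text \<open>
  The union of all powers of \<open>W\<close> is open, because multiplying on the left by a neighbourhood of the
  identity inside \<open>W\<close> raises the exponent by one. It is closed in the group for
  the same reason: an element of its closure differs from some point of the union by a left factor
  in \<open>W\<close>. So it contains the identity component, and the neighbourhoods just used form an open
  cover of \<open>C\<close>.
\<close>

lemma compact_subset_set_power:
  assumes "unit_nhd H W" "compact C" "C \<subseteq> H\<^sub>0"
  obtains k where "C \<subseteq> set_power W k"
proof -
  obtain T where T: "openin (top_of_set H) T" "mat 1 \<in> T" "T \<subseteq> W" and WH: "W \<subseteq> H"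
    using assms(1) by (auto simp: unit_nhd_def)
  define N where "N g = {b \<in> H. b ** matrix_inv g \<in> T}" for g
  have N: "openin (top_of_set H) (N g)" "g \<in> N g" if "g \<in> H" for g
    using that T by (auto simp: N_def intro: openin_right_preimage)
  have N_power: "N g \<subseteq> set_power W (Suc k)" if g: "g \<in> set_power W k" for g k
  proof
    fix b assume b: "b \<in> N g"
    have "g \<in> H" using g set_power_subset[OF WH] by blast
    moreover have "(b ** matrix_inv g) ** g \<in> set_power W (Suc k)"
      using b T(3) g by (intro set_power_Suc_I) (auto simp: N_def)
    ultimately show "b \<in> set_power W (Suc k)" by simp
  qed
  define G where "G = (\<Union>k. set_power W k)"
  have GH: "G \<subseteq> H" using set_power_subset[OF WH] by (auto simp: G_def)
  have "openin (top_of_set H) G"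
  proof (subst openin_subopen, intro ballI)
    fix g assume "g \<in> G"
    then obtain k where k: "g \<in> set_power W k" by (auto simp: G_def)
    have "N g \<subseteq> G" using N_power[OF k] unfolding G_def by blast
    then show "\<exists>T'. openin (top_of_set H) T' \<and> g \<in> T' \<and> T' \<subseteq> G"
      using N[of g] GH \<open>g \<in> G\<close> by blast
  qed
  moreover have "openin (top_of_set H) (H - G)"
  proof (subst openin_subopen, intro ballI)
    fix g assume g: "g \<in> H - G"
    define M where "M = {c \<in> H. g ** matrix_inv c \<in> T}"
    have "openin (top_of_set H) (H \<inter> (\<lambda>c. g ** matrix_inv c) -` T)"
      using T(1) g by (intro continuous_openin_preimage[where T = H] continuous_intros continuous_inv) auto
    then have "openin (top_of_set H) M" by (simp add: M_def vimage_def Int_def)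
    moreover have "g \<in> M" using g T by (simp add: M_def)
    moreover have "M \<subseteq> H - G"
    proof
      fix c assume c: "c \<in> M"
      have "c \<notin> G"
      proof
        assume "c \<in> G"
        then obtain k where "c \<in> set_power W k" by (auto simp: G_def)
        then have "(g ** matrix_inv c) ** c \<in> set_power W (Suc k)"
          using c T(3) by (intro set_power_Suc_I) (auto simp: M_def)
        then have "g \<in> set_power W (Suc k)" using c by (simp add: M_def)
        then show False using g unfolding G_def by blast
      qed
      then show "c \<in> H - G" using c by (simp add: M_def)
    qed
    ultimately show "\<exists>T'. openin (top_of_set H) T' \<and> g \<in> T' \<and> T' \<subseteq> H - G" by blast
  qed
  ultimately have "H\<^sub>0 \<subseteq> G"
  proof -
    assume o: "openin (top_of_set H) G" "openin (top_of_set H) (H - G)"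
    have "mat 1 \<in> set_power W 0" by simp
    then have "mat 1 \<in> G" unfolding G_def by blast
    obtain A B where AB: "open A" "G = H \<inter> A" "open B" "H - G = H \<inter> B"
      using o unfolding openin_open by blast
    have "A \<inter> B \<inter> H\<^sub>0 = {}" "H\<^sub>0 \<subseteq> A \<union> B" using AB identity_component_subset by blast+
    then have "A \<inter> H\<^sub>0 = {} \<or> B \<inter> H\<^sub>0 = {}"
      using connectedD[OF connected_connected_component AB(1,3)] by blast
    with \<open>mat 1 \<in> G\<close> one_mem_identity_component AB identity_component_subset
    show ?thesis by blast
  qed
  then have CG: "C \<subseteq> G" "C \<subseteq> H" using assms(3) identity_component_subset by blast+
  obtain F where F: "finite F" "F \<subseteq> C" "C \<subseteq> (\<Union>g\<in>F. N g)"
    using compact_openin_cover[of C N] assms(2) CG N by (metis subsetD)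
  have "\<forall>g\<in>F. \<exists>k. g \<in> set_power W k" using F CG by (auto simp: G_def)
  then obtain \<kappa> where \<kappa>: "\<And>g. g \<in> F \<Longrightarrow> g \<in> set_power W (\<kappa> g)" by metis
  have "N g \<subseteq> set_power W (Suc (Max (\<kappa> ` F)))" if "g \<in> F" for g
  proof -
    have "\<kappa> g \<le> Max (\<kappa> ` F)" using F(1) that by simp
    then have "set_power W (Suc (\<kappa> g)) \<subseteq> set_power W (Suc (Max (\<kappa> ` F)))"
      using T by (intro set_power_mono) auto
    then show ?thesis using N_power[OF \<kappa>[OF that]] by blast
  qed
  then show ?thesis using F(3) that[of "Suc (Max (\<kappa> ` F))"] by blast
qed

subsection \<open>Counting separated families\<close>

text \<open>
  Choose the neighbourhood \<open>N a\<close> of \<open>a\<close> so small that \<open>g \<in> N a\<close> implies \<open>a \<in> g V\<close>. If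
  \<open>matrix_inv x ** h i\<close> and \<open>matrix_inv x ** h j\<close> lie in the same \<open>N a\<close>, then \<open>x ** a\<close> belongs to
  the translates of \<open>V\<close> by \<open>h i\<close> and by \<open>h j\<close>, so the indices agree. Hence a finite cover of \<open>D\<close> by such neighbourhoods bounds
  the number of indices, and it does not depend on \<open>x\<close>.
\<close>

lemma separated_count:
  assumes V: "unit_nhd H V" and h: "h \<in> I \<rightarrow> H"
    and sep: "\<forall>i\<in>I. \<forall>j\<in>I. i \<noteq> j \<longrightarrow> (\<lambda>v. h i ** v) ` V \<inter> (\<lambda>v. h j ** v) ` V = {}"
    and D: "compact D" "D \<subseteq> H"
  obtains M :: nat where
    "\<And>x. x \<in> H \<Longrightarrow> finite {j \<in> I. matrix_inv x ** h j \<in> D} \<and> card {j \<in> I. matrix_inv x ** h j \<in> D} \<le> M"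
proof -
  obtain T where T: "openin (top_of_set H) T" "mat 1 \<in> T" "T \<subseteq> V"
    using V by (auto simp: unit_nhd_def)
  define N where "N a = {g \<in> H. matrix_inv g ** a \<in> T}" for a
  have "openin (top_of_set H) (N a) \<and> a \<in> N a" if "a \<in> H" for a
  proof -
    have "openin (top_of_set H) (H \<inter> (\<lambda>g. matrix_inv g ** a) -` T)"
      using T(1) that by (intro continuous_openin_preimage[where T = H] continuous_intros continuous_inv) auto
    then show ?thesis using that T by (simp add: N_def vimage_def Int_def)
  qed
  then obtain F where F: "finite F" "F \<subseteq> D" "D \<subseteq> (\<Union>a\<in>F. N a)"
    using compact_openin_cover[of D N] D by (metis subsetD)
  show ?thesis
  proof (rule that[of "card F"])
    fix x assume x: "x \<in> H"
    define J where "J = {j \<in> I. matrix_inv x ** h j \<in> D}"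
    have "\<forall>j\<in>J. \<exists>a\<in>F. matrix_inv x ** h j \<in> N a" using F(3) unfolding J_def by blast
    then obtain \<alpha> where \<alpha>: "\<And>j. j \<in> J \<Longrightarrow> \<alpha> j \<in> F \<and> matrix_inv x ** h j \<in> N (\<alpha> j)" by metis
    have mem: "x ** \<alpha> j \<in> (\<lambda>v. h j ** v) ` V" if j: "j \<in> J" for j
    proof -
      have hj: "h j \<in> H" using j h by (auto simp: J_def)
      have "matrix_inv (matrix_inv x ** h j) = matrix_inv (h j) ** x"
        using x hj by (intro matrix_inv_eqI) (simp add: matrix_mul_assoc)
      then have "(matrix_inv (h j) ** x) ** \<alpha> j \<in> V"
        using \<alpha>[OF j] T(3) by (auto simp: N_def)
      moreover have "h j ** ((matrix_inv (h j) ** x) ** \<alpha> j) = x ** \<alpha> j"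
        using hj by (simp flip: matrix_mul_assoc)
      ultimately show ?thesis by (metis imageI)
    qed
    have "inj_on \<alpha> J"
    proof (rule inj_onI, rule ccontr)
      fix i j assume ij: "i \<in> J" "j \<in> J" "\<alpha> i = \<alpha> j" "i \<noteq> j"
      then have "i \<in> I" "j \<in> I" by (auto simp: J_def)
      with sep ij(4) have "(\<lambda>v. h i ** v) ` V \<inter> (\<lambda>v. h j ** v) ` V = {}" by blast
      then show False using mem[OF ij(1)] mem[OF ij(2)] ij(3) by auto
    qed
    moreover have "\<alpha> ` J \<subseteq> F" using \<alpha> by blast
    ultimately have "finite J \<and> card J \<le> card F"
      using F(1) by (metis card_image card_mono finite_subset finite_image_iff)
    then show "finite {j \<in> I. matrix_inv x ** h j \<in> D} \<and> card {j \<in> I. matrix_inv x ** h j \<in> D} \<le> card F"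
      by (simp add: J_def)
  qed
qed


section \<open>The orbit map\<close>

lemma orbit_fibres_compact:
  assumes "compact K" "K \<subseteq> H" "compact (isotropy H \<xi>)"
  obtains B where "compact B" "B \<subseteq> H" "\<And>a. a \<in> H \<Longrightarrow> dual_act a \<xi> \<in> (\<lambda>k. dual_act k \<xi>) ` K \<Longrightarrow> a \<in> B"
proof -
  have "isotropy H \<xi> \<subseteq> H" by (auto simp: isotropy_def)
  then obtain B where B: "compact B" "B \<subseteq> H" "\<And>k s. k \<in> K \<Longrightarrow> s \<in> isotropy H \<xi> \<Longrightarrow> k ** s \<in> B"
    using compact_mult[of K "isotropy H \<xi>"] assms by metis
  have "a \<in> B" if a: "a \<in> H" "dual_act a \<xi> \<in> (\<lambda>k. dual_act k \<xi>) ` K" for a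
  proof -
    obtain k where k: "k \<in> K" "dual_act a \<xi> = dual_act k \<xi>" using a(2) by blast
    then have "matrix_inv k ** a \<in> isotropy H \<xi>"
      using act_eq_iff[of k a \<xi>] a(1) assms(2) by (simp add: subset_iff)
    then have "k ** (matrix_inv k ** a) \<in> B" using B(3) k(1) by blast
    then show "a \<in> B" using k(1) assms(2) by (simp add: subset_iff)
  qed
  then show ?thesis using that[OF B(1,2)] by blast
qed

lemma act_image_eq_vimage:
  assumes "g \<in> H"
  shows "dual_act g ` Q = dual_act (matrix_inv g) -` Q"
proof (intro equalityI subsetI)
  fix y assume "y \<in> dual_act (matrix_inv g) -` Q"
  moreover have "y = dual_act g (dual_act (matrix_inv g) y)" using act_inv[of "matrix_inv g" y] assms by simp
  ultimately show "y \<in> dual_act g ` Q" by blast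
qed (use assms in auto)

text \<open>
  Every point of the orbit lies in a translate of the open set \<open>Q\<close>, so finitely many translates cover
  \<open>L\<close>. The preimage of each is a translate of the preimage of \<open>Q\<close>, which is contained in a
  compact product of \<open>K\<close> with the isotropy group.
\<close>

lemma orbit_map_proper:
  assumes K: "compact K" "K \<subseteq> H" and iso: "compact (isotropy H \<xi>)"
    and Q: "open Q" "Q \<noteq> {}" "Q \<subseteq> (\<lambda>k. dual_act k \<xi>) ` K"
    and L: "compact L" "L \<subseteq> dual_orbit H \<xi>"
  obtains D where "compact D" "D \<subseteq> H" "\<And>a. a \<in> H \<Longrightarrow> dual_act a \<xi> \<in> L \<Longrightarrow> a \<in> D"
proof -
  obtain B where B: "compact B" "B \<subseteq> H"
    "\<And>a. a \<in> H \<Longrightarrow> dual_act a \<xi> \<in> (\<lambda>k. dual_act k \<xi>) ` K \<Longrightarrow> a \<in> B"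
    using orbit_fibres_compact[OF K iso] by blast
  obtain k where k: "k \<in> K" "dual_act k \<xi> \<in> Q" using Q(2,3) by blast
  have kH: "k \<in> H" using k K by blast
  have op: "open (dual_act g ` Q)" if "g \<in> H" for g
    unfolding act_image_eq_vimage[OF that]
    using that Q(1) by (intro open_vimage continuous_dual_act) auto
  have cov: "L \<subseteq> (\<Union>g\<in>H. dual_act g ` Q)"
  proof
    fix \<eta> assume "\<eta> \<in> L"
    then obtain a where a: "a \<in> H" "\<eta> = dual_act a \<xi>" using L(2) by (auto simp: dual_orbit_def)
    have "\<eta> = dual_act (a ** matrix_inv k) (dual_act k \<xi>)"
      using a kH act_mult[of "a ** matrix_inv k" k \<xi>] by simp
    then show "\<eta> \<in> (\<Union>g\<in>H. dual_act g ` Q)" using a kH k(2) by (intro UN_I[of "a ** matrix_inv k"]) auto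
  qed
  obtain G where G: "G \<subseteq> H" "finite G" "L \<subseteq> (\<Union>g\<in>G. dual_act g ` Q)"
    using compactE_image[OF L(1) op cov] by blast
  obtain D where D: "compact D" "D \<subseteq> H" "\<And>g b. g \<in> G \<Longrightarrow> b \<in> B \<Longrightarrow> g ** b \<in> D"
    using compact_mult[of G B] G B finite_imp_compact by metis
  have "a \<in> D" if a: "a \<in> H" "dual_act a \<xi> \<in> L" for a
  proof -
    obtain g q where g: "g \<in> G" "q \<in> Q" "dual_act a \<xi> = dual_act g q" using a(2) G(3) by blast
    then have "dual_act (matrix_inv g ** a) \<xi> = q"
      using a(1) G(1) act_mult[of "matrix_inv g" a \<xi>] by (metis act_inv inv_mem subsetD)
    then have "matrix_inv g ** a \<in> B" using g G(1) a(1) Q(3) by (intro B(3)) auto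
    then have "g ** (matrix_inv g ** a) \<in> D" using D(3) g(1) by blast
    then show "a \<in> D" using g(1) G(1) by (simp add: subset_iff)
  qed
  then show ?thesis using that[OF D(1,2)] by blast
qed

text \<open>
  Proper maps into locally compact spaces are closed: near a point of the orbit only the part of \<open>S\<close>
  over a closed ball matters, and that part is compact.
\<close>

lemma proper_orbit_map_closed:
  assumes "open (dual_orbit H \<xi>)"
    and proper: "\<And>L. compact L \<Longrightarrow> L \<subseteq> dual_orbit H \<xi> \<Longrightarrow>
      \<exists>D. compact D \<and> D \<subseteq> H \<and> (\<forall>a\<in>H. dual_act a \<xi> \<in> L \<longrightarrow> a \<in> D)"
    and S: "closedin (top_of_set H) S"
  shows "open (dual_orbit H \<xi> - (\<lambda>a. dual_act a \<xi>) ` S)"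
proof (subst open_subopen, intro ballI)
  fix \<eta> assume \<eta>: "\<eta> \<in> dual_orbit H \<xi> - (\<lambda>a. dual_act a \<xi>) ` S"
  then obtain e where e: "e > 0" "cball \<eta> e \<subseteq> dual_orbit H \<xi>"
    using assms(1) open_contains_cball by blast
  obtain D where D: "compact D" "D \<subseteq> H" "\<forall>a\<in>H. dual_act a \<xi> \<in> cball \<eta> e \<longrightarrow> a \<in> D"
    using proper[OF compact_cball e(2)] by blast
  have SH: "S \<subseteq> H" using S closedin_imp_subset by blast
  obtain S' where S': "closed S'" "S = H \<inter> S'" using S by (auto simp: closedin_closed)
  have "S \<inter> D = S' \<inter> D" using S' D(2) by blast
  then have "compact (S \<inter> D)" using S' D(1) by (simp add: closed_Int_compact)
  then have "compact ((\<lambda>a. dual_act a \<xi>) ` (S \<inter> D))"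
    using D(2) by (intro compact_continuous_image continuous_act) auto
  then have "open (ball \<eta> e - (\<lambda>a. dual_act a \<xi>) ` (S \<inter> D))"
    by (intro open_Diff compact_imp_closed) auto
  moreover have "\<eta> \<in> ball \<eta> e - (\<lambda>a. dual_act a \<xi>) ` (S \<inter> D)" using \<eta> e by auto
  moreover have "ball \<eta> e - (\<lambda>a. dual_act a \<xi>) ` (S \<inter> D) \<subseteq> dual_orbit H \<xi> - (\<lambda>a. dual_act a \<xi>) ` S"
  proof
    fix y assume y: "y \<in> ball \<eta> e - (\<lambda>a. dual_act a \<xi>) ` (S \<inter> D)"
    then have yc: "y \<in> cball \<eta> e" by auto
    have "y \<notin> (\<lambda>a. dual_act a \<xi>) ` S"
    proof
      assume "y \<in> (\<lambda>a. dual_act a \<xi>) ` S"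
      then obtain a where "a \<in> S" "y = dual_act a \<xi>" by blast
      then show False using y yc D(3) SH by blast
    qed
    then show "y \<in> dual_orbit H \<xi> - (\<lambda>a. dual_act a \<xi>) ` S" using yc e(2) by blast
  qed
  ultimately show "\<exists>T. open T \<and> \<eta> \<in> T \<and> T \<subseteq> dual_orbit H \<xi> - (\<lambda>a. dual_act a \<xi>) ` S" by blast
qed

text \<open>
  The coset \<open>A\<close> of \<open>a\<close> and its complement are both closed, so their images have open complements in the
  orbit. These complements cover the orbit because the images are disjoint: two group elements with
  the same image differ by an element of the isotropy group and hence of the identity component. So
  the image of \<open>A\<close> separates the orbit, and a connected set cannot meet both parts.
\<close>

lemma connected_in_orbit_same_coset:
  assumes closed_image: "\<And>S. closedin (top_of_set H) S \<Longrightarrow> open (dual_orbit H \<xi> - (\<lambda>a. dual_act a \<xi>) ` S)"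
    and H0: "openin (top_of_set H) H\<^sub>0" and iso: "isotropy H \<xi> \<subseteq> H\<^sub>0"
    and S: "connected S" "S \<subseteq> dual_orbit H \<xi>"
    and a: "a \<in> H" "dual_act a \<xi> \<in> S" and b: "b \<in> H" "dual_act b \<xi> \<in> S"
  shows "matrix_inv a ** b \<in> H\<^sub>0"
proof -
  define A where "A = {c \<in> H. matrix_inv a ** c \<in> H\<^sub>0}"
  have "openin (top_of_set H) A" "closedin (top_of_set H) A"
    unfolding A_def
    by (rule openin_left_preimage[OF H0 a(1)] closedin_left_preimage[OF closedin_connected_component a(1)])+
  then have clo: "closedin (top_of_set H) A" "closedin (top_of_set H) (H - A)" by auto
  have disj: "dual_act c \<xi> \<noteq> dual_act c' \<xi>" if "c \<in> A" "c' \<in> H - A" for c c'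
  proof
    assume "dual_act c \<xi> = dual_act c' \<xi>"
    with that have "matrix_inv c ** c' \<in> H\<^sub>0" using act_eq_iff[of c c' \<xi>] iso by (auto simp: A_def)
    moreover have cH: "c \<in> H" "matrix_inv a ** c \<in> H\<^sub>0" using that by (auto simp: A_def)
    ultimately have "(matrix_inv a ** c) ** (matrix_inv c ** c') \<in> H\<^sub>0"
by (metis identity_component_mult)
    then have "matrix_inv a ** c' \<in> H\<^sub>0" using cH by (simp flip: matrix_mul_assoc)
    then show False using that by (auto simp: A_def)
  qed
  let ?p = "\<lambda>c. dual_act c \<xi>"
  let ?U = "dual_orbit H \<xi> - ?p ` A" and ?V = "dual_orbit H \<xi> - ?p ` (H - A)"
  have "open ?U" "open ?V" using clo closed_image by blast+
  moreover have "?U \<inter> ?V \<inter> S = {}" by (auto simp: dual_orbit_def)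
  moreover have "S \<subseteq> ?U \<union> ?V" using S(2) disj by blast
  ultimately have "?U \<inter> S = {} \<or> ?V \<inter> S = {}" using connectedD[OF S(1)] by blast
  moreover have "?p a \<in> ?V"
  proof -
    have "a \<in> A" using a(1) one_mem_identity_component by (simp add: A_def)
    then show ?thesis using disj a by (auto simp: dual_orbit_def)
  qed
  ultimately have "?p b \<notin> ?U" using a(2) b(2) by blast
  then have "?p b \<in> ?p ` A" using b S(2) by blast
  then obtain c where "c \<in> A" "?p b = ?p c" by blast
  then have "b \<in> A" using disj[of c b] b(1) by auto
  then show ?thesis by (simp add: A_def)
qed

lemma dual_orbit_eq:
  assumes "\<xi> \<in> dual_orbit H \<eta>"
  shows "dual_orbit H \<xi> = dual_orbit H \<eta>"
proof -
  obtain a where a: "a \<in> H" "\<xi> = dual_act a \<eta>" using assms by (auto simp: dual_orbit_def)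
  have "dual_act c \<xi> \<in> dual_orbit H \<eta>" "dual_act c \<eta> \<in> dual_orbit H \<xi>" if c: "c \<in> H" for c
  proof -
    have "dual_act c \<xi> = dual_act (c ** a) \<eta>" using a c by (simp add: act_mult)
    then show "dual_act c \<xi> \<in> dual_orbit H \<eta>" using a c by (auto simp: dual_orbit_def)
    have "dual_act c \<eta> = dual_act (c ** matrix_inv a) \<xi>" using a c by (simp add: act_mult)
    then show "dual_act c \<eta> \<in> dual_orbit H \<xi>"
      using a c unfolding dual_orbit_def by (intro image_eqI[of _ _ "c ** matrix_inv a"]) auto
  qed
  then show ?thesis by (auto simp: dual_orbit_def)
qed

end


section \<open>The orbit map as a quasi-isometry\<close>

theorem theorem4p16:
  fixes H W :: "(real^'n^'n) set" and \<O> Q :: "(real^'n) set" and \<xi> :: "real^'n"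
    and I :: "'i set" and h :: "'i \<Rightarrow> real^'n^'n"
  defines "H\<^sub>0 \<equiv> connected_component_set H (mat 1)"
    and "\<Q> \<equiv> cover_member h Q ` I"
  assumes "admissible_dilation_group H \<O>"
    and "\<xi> \<in> \<O>"
    and "isotropy H \<xi> \<subseteq> H\<^sub>0"
    and "unit_nhd H W" and "relatively_compact_in H W" and "matrix_inv ` W = W" and "W \<subseteq> H\<^sub>0"
    and "induced_connected_covering H \<O> I h Q"
    and "\<xi> \<in> Q"
  shows "quasi_isometry H (word_dist W) \<O> (cover_dist \<Q>) (\<lambda>h. dual_act h \<xi>) \<and>
         coarsely_equivalent H (word_dist W) \<O> (cover_dist \<Q>)"
proof -
  let ?p = "\<lambda>a. dual_act a \<xi>"
  have "closed_subgroup_GL H" using assms(3) by (simp add: admissible_dilation_group_def)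
  then interpret matrix_group H
    unfolding closed_subgroup_GL_def by unfold_locales (auto dest: closedin_imp_subset)
  have H0: "openin (top_of_set H) H\<^sub>0"
    using openin_identity_component assms(6,9) by (simp add: H\<^sub>0_def)

  have "\<O> \<in> {X. (\<exists>\<xi>. X = dual_orbit H \<xi>) \<and> open X}"
    using assms(3) by (simp add: admissible_dilation_group_def)
  then obtain \<eta> where "\<O> = dual_orbit H \<eta>" and openO: "open \<O>" by blast
  then have orbit: "\<O> = dual_orbit H \<zeta>" if "\<zeta> \<in> \<O>" for \<zeta> using dual_orbit_eq that by blast
  have O: "\<O> = ?p ` H" using orbit[OF assms(4)] by (simp add: dual_orbit_def)
  have iso: "compact (isotropy H \<xi>)" using assms(3,4) by (simp add: admissible_dilation_group_def)

  obtain U \<xi>\<^sub>0 where \<xi>\<^sub>0: "\<xi>\<^sub>0 \<in> \<O>" and ws: "well_spread H U I h" and Q: "Q = (\<lambda>u. dual_act u \<xi>\<^sub>0) ` U"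
    using assms(10) by (auto simp: induced_connected_covering_def induced_covering_def)
  have memb: "open P" "connected P" if "P \<in> \<Q>" for P
    using assms(10) that by (auto simp: induced_connected_covering_def \<Q>_def)
  have openQ: "open Q"
    using assms(10) by (simp add: induced_connected_covering_def structured_admissible_def)
  obtain V where hH: "h \<in> I \<rightarrow> H" and UH: "U \<subseteq> H" and Ucov: "(\<Union>i\<in>I. (\<lambda>u. h i ** u) ` U) = H"
    and Urc: "relatively_compact_in H U" and V: "unit_nhd H V"
      "\<forall>i\<in>I. \<forall>j\<in>I. i \<noteq> j \<longrightarrow> (\<lambda>v. h i ** v) ` V \<inter> (\<lambda>v. h j ** v) ` V = {}"
    using ws by (auto simp: well_spread_def unit_nhd_def)
  have QO: "\<Union>\<Q> = \<O>"
  proof (intro equalityI subsetI)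
    fix y assume "y \<in> \<Union>\<Q>"
    then obtain i u where "i \<in> I" "u \<in> U" "y = dual_act (h i) (dual_act u \<xi>\<^sub>0)"
      by (auto simp: \<Q>_def cover_member_def Q)
    then have "y = dual_act (h i ** u) \<xi>\<^sub>0" "h i ** u \<in> H" using hH UH by (auto simp: act_mult subset_iff Pi_iff)
    then show "y \<in> \<O>" using orbit[OF \<xi>\<^sub>0] by (auto simp: dual_orbit_def)
  next
    fix y assume "y \<in> \<O>"
    then obtain g where g: "g \<in> H" "y = dual_act g \<xi>\<^sub>0" using orbit[OF \<xi>\<^sub>0] by (auto simp: dual_orbit_def)
    then obtain i u where iu: "i \<in> I" "u \<in> U" "g = h i ** u" using Ucov by blast
    then have "y = dual_act (h i) (dual_act u \<xi>\<^sub>0)" using g hH UH by (auto simp: act_mult subset_iff Pi_iff)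
    then show "y \<in> \<Union>\<Q>" using iu by (auto simp: \<Q>_def cover_member_def Q)
  qed

  \<comment> \<open>\<open>Q\<close> is given as an orbit piece of \<open>\<xi>\<^sub>0\<close>; right multiplication by an inverse moves the base point to \<open>\<xi>\<close>.\<close>
  obtain K where K: "compact K" "K \<subseteq> H" "Q \<subseteq> ?p ` K"
  proof -
    obtain U' where U': "compact U'" "U \<subseteq> U'" "U' \<subseteq> H" using relatively_compact_inE[OF Urc] by metis
    obtain u where u: "u \<in> U" "\<xi> = dual_act u \<xi>\<^sub>0" using assms(11) Q by blast
    then have uH: "u \<in> H" using UH by blast
    obtain K where K: "compact K" "K \<subseteq> H" "\<And>a b. a \<in> U' \<Longrightarrow> b \<in> {matrix_inv u} \<Longrightarrow> a ** b \<in> K"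
      using compact_mult[of U' "{matrix_inv u}"] U' uH by (metis compact_sing empty_subsetI insert_subset inv_mem)
    have "dual_act a \<xi>\<^sub>0 \<in> ?p ` K" if "a \<in> U" for a
    proof -
      have "dual_act a \<xi>\<^sub>0 = ?p (a ** matrix_inv u)" using that u uH UH by (simp add: act_mult subset_iff)
      then show ?thesis using K(3) that U' by blast
    qed
    then show ?thesis using that[of K] K(1,2) Q by blast
  qed
  have Qne: "Q \<noteq> {}" using assms(11) by blast
  have proper: "\<exists>D. compact D \<and> D \<subseteq> H \<and> (\<forall>a\<in>H. ?p a \<in> L \<longrightarrow> a \<in> D)"
    if "compact L" "L \<subseteq> \<O>" for L
    using orbit_map_proper[OF K(1,2) iso openQ Qne K(3) that(1)] that(2) orbit[OF assms(4)] by metis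
  have coset: "matrix_inv a ** b \<in> H\<^sub>0"
    if "connected S" "S \<subseteq> \<O>" "a \<in> H" "?p a \<in> S" "b \<in> H" "?p b \<in> S" for S a b
  proof -
    have "open (dual_orbit H \<xi> - ?p ` S)" if "closedin (top_of_set H) S" for S
      using proper_orbit_map_closed[of \<xi> S] openO proper that orbit[OF assms(4)] by simp
    then show ?thesis unfolding H\<^sub>0_def
      by (rule connected_in_orbit_same_coset[where \<xi> = \<xi> and S = S])
        (use that H0 assms(5) orbit[OF assms(4)] in \<open>simp_all add: H\<^sub>0_def\<close>)
  qed

  \<comment> \<open>One link of a chain costs at most \<open>k\<close> letters.\<close>
  obtain k where k: "k > 0" and link_word: "\<And>x y. x \<in> H \<Longrightarrow> y \<in> H \<Longrightarrow> (?p x, ?p y) \<in> link \<Q> \<Longrightarrow>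
      matrix_inv x ** y \<in> set_power W k"
  proof -
    obtain B where B: "compact B" "B \<subseteq> H" "\<And>a. a \<in> H \<Longrightarrow> ?p a \<in> ?p ` K \<Longrightarrow> a \<in> B"
      using orbit_fibres_compact[OF K(1,2) iso] by blast
    obtain C where C: "compact C" "C \<subseteq> H" "\<And>a b. a \<in> matrix_inv ` B \<Longrightarrow> b \<in> B \<Longrightarrow> a ** b \<in> C"
      using compact_mult[of "matrix_inv ` B" B] compact_inv[OF B(1,2)] B(1,2) by metis
    obtain H' where H': "closed H'" "H\<^sub>0 = H \<inter> H'"
      using closedin_connected_component[of H "mat 1"] by (auto simp: H\<^sub>0_def closedin_closed)
    have "compact (C \<inter> H\<^sub>0)"
      using compact_Int_closed[OF C(1) H'(1)] C(2) H'(2) by (metis inf.absorb1 inf_assoc)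
    then obtain k where k: "C \<inter> H\<^sub>0 \<subseteq> set_power W k"
      using compact_subset_set_power[OF assms(6)] unfolding H\<^sub>0_def by (metis inf_le2)
    \<comment> \<open>The successor only ensures that the exponent is positive.\<close>
    have "matrix_inv x ** y \<in> set_power W (Suc k)"
      if xy: "x \<in> H" "y \<in> H" "(?p x, ?p y) \<in> link \<Q>" for x y
    proof -
      obtain i where i: "i \<in> I" "?p x \<in> cover_member h Q i" "?p y \<in> cover_member h Q i"
        using xy(3) by (auto simp: link_def \<Q>_def)
      have iQ: "cover_member h Q i \<in> \<Q>" using i by (simp add: \<Q>_def)
      have hi: "h i \<in> H" using hH i by auto
      have mem_B: "matrix_inv (h i) ** c \<in> B" if c: "c \<in> H" "?p c \<in> cover_member h Q i" for c
      proof -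
        obtain q where q: "q \<in> Q" "?p c = dual_act (h i) q" using c(2) by (auto simp: cover_member_def)
        then have "?p (matrix_inv (h i) ** c) = q" using hi c(1) by (simp add: act_mult)
        then show ?thesis using B(3)[of "matrix_inv (h i) ** c"] q(1) K(3) hi c(1) by auto
      qed
      have "matrix_inv (matrix_inv (h i) ** x) = matrix_inv x ** h i"
        using xy hi by (intro matrix_inv_eqI) (simp add: matrix_mul_assoc)
      then have "matrix_inv x ** h i \<in> matrix_inv ` B" using mem_B[OF xy(1) i(2)] by (metis imageI)
      then have "(matrix_inv x ** h i) ** (matrix_inv (h i) ** y) \<in> C"
        using mem_B[OF xy(2) i(3)] by (rule C(3))
      then have "matrix_inv x ** y \<in> C" using hi by (simp flip: matrix_mul_assoc)
      moreover have "matrix_inv x ** y \<in> H\<^sub>0"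
        using memb(2)[OF iQ] iQ QO xy i by (intro coset[of "cover_member h Q i"]) auto
      moreover have "mat 1 \<in> W" using assms(6) by (auto simp: unit_nhd_def)
      ultimately show ?thesis using k set_power_mono[of W k "Suc k"] by auto
    qed
    then show ?thesis using that[of "Suc k"] by blast
  qed
  \<comment> \<open>Equal images lie in a common member and so cost one link as well; hence the successor of \<open>m\<close>.\<close>
  have chain_word: "matrix_inv x ** y \<in> set_power W (k * Suc m)"
    if "x \<in> H" "y \<in> H" "(?p x, ?p y) \<in> link \<Q> ^^ m" for x y m
    using that(2-)
  proof (induction m arbitrary: y)
    case 0
    have "?p x \<in> \<Union>\<Q>" using QO O that(1) by blast
    then have "(?p x, ?p y) \<in> link \<Q>" using 0(2) by (auto intro: linkI)
    then show ?case using link_word that(1) 0(1) by simp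
  next
    case (Suc m)
    then obtain \<zeta> where \<zeta>: "(?p x, \<zeta>) \<in> link \<Q> ^^ m" "(\<zeta>, ?p y) \<in> link \<Q>" by auto
    then have "\<zeta> \<in> \<O>" using QO by (auto simp: link_def)
    then obtain z where z: "z \<in> H" "\<zeta> = ?p z" using O by blast
    have "(matrix_inv x ** z) ** (matrix_inv z ** y) \<in> set_power W (k * Suc m + k)"
      using Suc.IH[OF z(1)] link_word[OF z(1) Suc.prems(1)] \<zeta> z(2) by (intro set_power_add) auto
    then show ?case using z(1) by (simp add: algebra_simps flip: matrix_mul_assoc)
  qed

  \<comment> \<open>One letter of a word costs at most \<open>M\<close> links.\<close>
  obtain M where M: "M > 0" and word_link: "\<And>x w. x \<in> H \<Longrightarrow> w \<in> W \<Longrightarrow> (?p x, ?p (x ** w)) \<in> link \<Q> ^^ M"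
  proof -
    obtain W' where W': "compact W'" "W \<subseteq> W'" "W' \<subseteq> H" "W' \<subseteq> H\<^sub>0"
      using relatively_compact_inE[OF assms(7)] closedin_connected_component assms(9)
      unfolding H\<^sub>0_def by metis
    have H0H: "H\<^sub>0 \<subseteq> H" using identity_component_subset by (simp add: H\<^sub>0_def)
    have conn: "connected (?p ` H\<^sub>0)"
      using H0H unfolding H\<^sub>0_def by (intro connected_continuous_image continuous_act) auto
    have sub: "?p ` H\<^sub>0 \<subseteq> \<O>" using H0H O by blast
    have comp: "compact (?p ` W')"
      using W' by (intro compact_continuous_image continuous_act) auto
    have \<xi>H0: "\<xi> \<in> ?p ` H\<^sub>0"
      using one_mem_identity_component unfolding H\<^sub>0_def by (intro image_eqI[of _ _ "mat 1"]) auto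
    obtain Z where Z: "compact Z" "connected Z" "\<xi> \<in> Z" "?p ` W' \<subseteq> Z" "Z \<subseteq> \<O>"
      using compact_connected_superset[OF openO conn sub comp image_mono[OF W'(4)] \<xi>H0] by blast
    obtain D\<^sub>Z where DZ: "compact D\<^sub>Z" "D\<^sub>Z \<subseteq> H" "\<forall>a\<in>H. ?p a \<in> Z \<longrightarrow> a \<in> D\<^sub>Z"
      using proper[OF Z(1,5)] by blast
    obtain D where D: "compact D" "D \<subseteq> H" "\<And>a b. a \<in> D\<^sub>Z \<Longrightarrow> b \<in> matrix_inv ` K \<Longrightarrow> a ** b \<in> D"
      using compact_mult[of D\<^sub>Z "matrix_inv ` K"] compact_inv[OF K(1,2)] DZ by metis
    obtain M where M: "\<And>x. x \<in> H \<Longrightarrow> finite {j \<in> I. matrix_inv x ** h j \<in> D} \<and>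
        card {j \<in> I. matrix_inv x ** h j \<in> D} \<le> M"
      using separated_count[OF V(1) hH V(2) D(1,2)] by blast
    have "(?p x, ?p (x ** w)) \<in> link \<Q> ^^ Suc M" if xw: "x \<in> H" "w \<in> W" for x w
    proof -
      have wH: "w \<in> H" using xw W' by blast
      define J where "J = {j \<in> I. matrix_inv x ** h j \<in> D}"
      have J: "finite J" "card J \<le> M" using M[OF xw(1)] by (auto simp: J_def)
      define S where "S = dual_act x ` Z"
      have "connected S"
        unfolding S_def using Z xw by (intro connected_continuous_image continuous_dual_act) auto
      have "S \<subseteq> \<O>"
      proof
        fix y assume "y \<in> S"
        then obtain a where "a \<in> H" "y = dual_act x (?p a)" using Z(5) O by (auto simp: S_def)
        then have "y = ?p (x ** a)" "x ** a \<in> H" using xw by (auto simp: act_mult)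
        then show "y \<in> \<O>" using O by blast
      qed
      \<comment> \<open>A member that meets the translate of \<open>Z\<close> has \<open>matrix_inv x ** h j\<close> in \<open>D\<close>.\<close>
      have "S \<subseteq> \<Union>(cover_member h Q ` J)"
      proof
        fix y assume y: "y \<in> S"
        then obtain j where j: "j \<in> I" "y \<in> cover_member h Q j"
          using \<open>S \<subseteq> \<O>\<close> QO by (auto simp: \<Q>_def)
        then have hj: "h j \<in> H" using hH by auto
        obtain q where q: "q \<in> Q" "y = dual_act (h j) q" using j by (auto simp: cover_member_def)
        then obtain b where b: "b \<in> K" "q = ?p b" using K(3) by blast
        then have bH: "b \<in> H" using K by blast
        obtain z where z: "z \<in> Z" "y = dual_act x z" using y by (auto simp: S_def)
        have "?p (matrix_inv x ** h j ** b) = dual_act (matrix_inv x) y"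
          using q b bH hj xw by (simp add: act_mult)
        also have "\<dots> = z" using z xw by simp
        finally have "matrix_inv x ** h j ** b \<in> D\<^sub>Z" using DZ(3) z(1) bH hj xw by auto
        then have "(matrix_inv x ** h j ** b) ** matrix_inv b \<in> D" using b by (intro D(3)) auto
        then have "j \<in> J" using j bH by (simp add: J_def)
        then show "y \<in> \<Union>(cover_member h Q ` J)" using j by blast
      qed
      moreover have JQ: "cover_member h Q ` J \<subseteq> \<Q>" by (auto simp: J_def \<Q>_def)
      moreover have "?p x \<in> S" using Z(3) by (auto simp: S_def)
      moreover have "?p (x ** w) \<in> S"
        using Z(4) W'(2) xw wH by (auto simp: S_def act_mult)
      ultimately obtain m where m: "m \<le> card (cover_member h Q ` J)" "(?p x, ?p (x ** w)) \<in> link \<Q> ^^ m"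
        using connected_chain_bound[OF \<open>connected S\<close>, of "cover_member h Q ` J" \<Q> "?p x" "?p (x ** w)"]
          J(1) memb(1) by blast
      have "m \<le> Suc M" using m(1) card_image_le[OF J(1), of "cover_member h Q"] J(2) by linarith
      moreover have "?p (x ** w) \<in> \<Union>\<Q>" using QO O xw wH by auto
      ultimately show ?thesis using relpow_link_mono[OF m(2)] by blast
    qed
    then show ?thesis using that[of "Suc M"] by blast
  qed
  have WH: "W \<subseteq> H" using assms(6) by (simp add: unit_nhd_def)
  have power_link: "(?p x, ?p (x ** v)) \<in> link \<Q> ^^ (M * m)" if "x \<in> H" "v \<in> set_power W m" for x v m
    using that
  proof (induction m arbitrary: x v)
    case (Suc m)
    then obtain w v' where v: "v = w ** v'" "w \<in> W" "v' \<in> set_power W m" by auto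
    have "x ** w \<in> H" using Suc.prems(1) v(2) WH by (blast intro: mult_mem)
    from relpow_trans[OF word_link[OF Suc.prems(1) v(2)] Suc.IH[OF this v(3)]]
    show ?case using v(1) by (simp add: matrix_mul_assoc)
  qed simp

  have upper: "cover_dist \<Q> (?p x) (?p y) \<le> ereal (real M) * word_dist W x y" if "x \<in> H" "y \<in> H" for x y
  proof (rule cover_dist_le_word_dist[of x y W ?p, OF _ M])
    fix m assume "matrix_inv x ** y \<in> set_power W m"
    then show "(?p x, ?p y) \<in> link \<Q> ^^ (M * m)"
      using power_link[of x "matrix_inv x ** y" m] that by simp
  qed
  have lower: "word_dist W x y \<le> ereal (real k) * (cover_dist \<Q> (?p x) (?p y) + 1)"
    if "x \<in> H" "y \<in> H" for x y
    by (rule word_dist_le_cover_dist[of ?p, OF chain_word[OF that] k])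

  let ?L = "real (k + M)"
  have two_sided: "ereal (inverse ?L) * word_dist W x y - ereal 1 \<le> cover_dist \<Q> (?p x) (?p y) \<and>
      cover_dist \<Q> (?p x) (?p y) \<le> ereal ?L * word_dist W x y + ereal 1"
    if xy: "x \<in> H" "y \<in> H" for x y
  proof
    have nn: "0 \<le> word_dist W x y" "0 \<le> cover_dist \<Q> (?p x) (?p y)"
      by (rule word_dist_nonneg cover_dist_nonneg)+
    have "word_dist W x y \<le> ereal ?L * (cover_dist \<Q> (?p x) (?p y) + 1)"
      using lower[OF xy] by (rule order_trans) (use nn in \<open>auto intro!: ereal_mult_right_mono\<close>)
    then show "ereal (inverse ?L) * word_dist W x y - ereal 1 \<le> cover_dist \<Q> (?p x) (?p y)"
      using nn k
      by (cases "word_dist W x y"; cases "cover_dist \<Q> (?p x) (?p y)") (auto simp: field_simps one_ereal_def)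
    have "cover_dist \<Q> (?p x) (?p y) \<le> ereal ?L * word_dist W x y"
      using upper[OF xy] by (rule order_trans) (use nn in \<open>auto intro!: ereal_mult_right_mono\<close>)
    also have "\<dots> \<le> ereal ?L * word_dist W x y + ereal 1"
      by (cases "ereal ?L * word_dist W x y") auto
    finally show "cover_dist \<Q> (?p x) (?p y) \<le> ereal ?L * word_dist W x y + ereal 1" .
  qed
  have "\<exists>x\<in>H. cover_dist \<Q> (?p x) y \<le> ereal 1" if "y \<in> \<O>" for y
  proof -
    obtain x where "x \<in> H" "y = ?p x" using \<open>y \<in> \<O>\<close> O by blast
    then show ?thesis by (intro bexI[of _ x]) (simp_all add: cover_dist_def)
  qed
  moreover have "?L > 0" using k by simp
  moreover have "?p \<in> H \<rightarrow> \<O>" using O by blast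
  ultimately have qi: "quasi_isometry H (word_dist W) \<O> (cover_dist \<Q>) ?p"
    unfolding quasi_isometry_def using two_sided zero_less_one by blast
  moreover have "coarsely_equivalent H (word_dist W) \<O> (cover_dist \<Q>)"
    by (rule surjective_quasi_isometry_coarsely_equivalent[OF qi]) (simp_all add: O cover_dist_def)
  ultimately show ?thesis ..
qed

end
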